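(* Let $\phi=(1+\sqrt5)/2$ and let $F_n$ be the Fibonacci numbers. For every positive integer $k$, \[ 2\tan^{-1}\left(\frac{1}{\phi^{2k}}\right)=\tan^{-1}\left(\frac{2}{F_{2k}\sqrt 5}\right). \]
   Context: $\phi=(1+\sqrt5)/2$ is the golden ratio. The Fibonacci numbers are defined by $F_0=0$, $F_1=1$, $F_n=F_{n-1}+F_{n-2}$. $\tan^{-1}$ denotes the principal branch of the arctangent, with values in $(-\pi/2,\pi/2)$. *)

theory Defs
  imports Complex_Main "HOL-Number_Theory.Fib"
begin

definition golden_ratio :: real ("\<phi>") where
  "\<phi> = (1 + sqrt 5) / 2"

end

theory Submission
  imports Defs
begin

text \<open>By the double-angle formula and Binet's formula: since \<open>\<phi>\<close> and its conjugate have product \<open>- 1\<close>,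
  \<open>F\<^sub>2\<^sub>k \<surd>5 = x - 1 / x\<close> with \<open>x = \<phi>\<^sup>2\<^sup>k > 1\<close>, and
  \<open>2 (1/x) / (1 - (1/x)\<^sup>2) = 2 / (x - 1/x)\<close>.\<close>

lemma golden_ratio_gt_1: "\<phi> > 1"
  unfolding golden_ratio_def by simp

text \<open>Lets Binet's formula be written in powers of \<open>\<phi>\<close> alone.\<close>

lemma golden_ratio_conjugate: "(1 - sqrt 5) / 2 = - (1 / \<phi>)"
proof -
  have "(1 - sqrt 5) / 2 * \<phi> = - 1"
    unfolding golden_ratio_def by (simp add: algebra_simps)
  then show ?thesis
    using golden_ratio_gt_1 by (simp add: field_simps)
qed

lemma fib_even_sqrt5:
  "real (fib (2 * k)) * sqrt 5 = \<phi> ^ (2 * k) - 1 / \<phi> ^ (2 * k)"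
proof -
  have "real (fib (2 * k)) = (\<phi> ^ (2 * k) - (- (1 / \<phi>)) ^ (2 * k)) / sqrt 5"
    using fib_closed_form[of "2 * k"]
    by (simp only: golden_ratio_conjugate golden_ratio_def[symmetric] Let_def)
  then show ?thesis
    \<comment> \<open>The exponent is even, so the sign of the conjugate root disappears.\<close>
    by (simp add: power_one_over)
qed

theorem theorem4:
  fixes k :: nat
  assumes "k > 0"
  shows "2 * arctan (1 / \<phi> ^ (2 * k)) = arctan (2 / (real (fib (2 * k)) * sqrt 5))"
proof -
  define x where "x = \<phi> ^ (2 * k)"
  \<comment> \<open>Strictness comes from \<open>k > 0\<close>; at \<open>k = 0\<close> the two
    sides would be pi/2 and, as 2 / 0 = 0, 0.\<close>
  have "x > 1"
    unfolding x_def using assms golden_ratio_gt_1 by (intro one_less_power) auto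
  \<comment> \<open>Since \<open>1 / x\<close> lies in (0, 1), the doubled angle stays below pi/2,
    on the principal branch.\<close>
  then have "2 * arctan (1 / x) = arctan (2 * (1 / x) / (1 - (1 / x)\<^sup>2))"
    by (intro arctan_double) simp
  also have "2 * (1 / x) / (1 - (1 / x)\<^sup>2) = 2 / (x - 1 / x)"
    using \<open>x > 1\<close> by (simp add: divide_simps power2_eq_square)
  finally show ?thesis
    unfolding x_def fib_even_sqrt5 .
qed

end
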